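(* Let $\alpha=(\alpha_i)_{i\geqslant 0}$ and $\beta=(\beta_i)_{i\geqslant 0}$ be two sequences starting with a common first term. Then the following hold. (1) If $\alpha_i=2^{i+1}-1$ and $\beta_i=2(1-2^{i-1})$ for all $i\geqslant 0$, then $\det P_{\alpha,\beta}(n)=\mathcal{J}_{n+2}$ for all $n\geqslant 0$. (2) If $\alpha_i=2^{i+2}-1$ and $\beta_i=2(2^{i-1}+1)$ for all $i\geqslant 0$, then $\det P_{\alpha,\beta}(n)=\mathcal{J}_{n+3}$ for all $n\geqslant 0$.
   Context: For sequences $\alpha,\beta$ with $\alpha_0=\beta_0$, the generalized Pascal triangle $P_{\alpha,\beta}(n)=[P_{i,j}]_{0\leqslant i,j\leqslant n}$ is the square matrix of order $n+1$ with $P_{i,0}=\alpha_i$, $P_{0,i}=\beta_i$ for $0\leqslant i\leqslant n$, and $P_{i,j}=P_{i,j-1}+P_{i-1,j}$ for $1\leqslant i,j\leqslant n$. $\mathcal{J}_n$ is the $n$th Jacobsthal number: $\mathcal{J}_0=0$, $\mathcal{J}_1=1$, $\mathcal{J}_n=\mathcal{J}_{n-1}+2\mathcal{J}_{n-2}$ for $n\geqslant 2$. *)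

theory Defs
  imports Complex_Main "Jordan_Normal_Form.Determinant"
begin

text \<open>
  The corner entry belongs to both boundary sequences. The first equation takes it from
  \<open>\<alpha>\<close>; the intended use is under the assumption \<open>\<alpha> 0 = \<beta> 0\<close>, where row 0 is
  \<open>\<beta>\<close> (see \<open>pascal_entry_row_0\<close>).
\<close>

fun pascal_entry :: "(nat \<Rightarrow> 'a::plus) \<Rightarrow> (nat \<Rightarrow> 'a) \<Rightarrow> nat \<Rightarrow> nat \<Rightarrow> 'a" where
  "pascal_entry \<alpha> \<beta> i 0 = \<alpha> i"
| "pascal_entry \<alpha> \<beta> 0 (Suc j) = \<beta> (Suc j)"
| "pascal_entry \<alpha> \<beta> (Suc i) (Suc j) =
     pascal_entry \<alpha> \<beta> (Suc i) j + pascal_entry \<alpha> \<beta> i (Suc j)"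

lemma pascal_entry_row_0: "\<alpha> 0 = \<beta> 0 \<Longrightarrow> pascal_entry \<alpha> \<beta> 0 j = \<beta> j"
  by (cases j) simp_all

definition pascal_mat :: "(nat \<Rightarrow> 'a::plus) \<Rightarrow> (nat \<Rightarrow> 'a) \<Rightarrow> nat \<Rightarrow> 'a mat" where
  "pascal_mat \<alpha> \<beta> n = mat (n + 1) (n + 1) (\<lambda>(i, j). pascal_entry \<alpha> \<beta> i j)"

fun jacobsthal :: "nat \<Rightarrow> nat" where
  "jacobsthal 0 = 0"
| "jacobsthal (Suc 0) = 1"
| "jacobsthal (Suc (Suc n)) = jacobsthal (Suc n) + 2 * jacobsthal n"

end

theory Submission
  imports Defs
begin

text \<open>
  A generalized Pascal triangle factors as \<open>L * T * L\<^sup>T\<close>, where \<open>L\<close> is the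
  unitriangular matrix of binomial coefficients and \<open>T\<close> is the Toeplitz matrix whose first column
  and first row are the inverse binomial transforms of \<open>\<alpha>\<close> and \<open>\<beta>\<close>. In both cases at hand \<open>T\<close> has
  constants \<open>d\<close> on, \<open>b\<close> below and \<open>a\<close> above the diagonal. Adding the same number \<open>x\<close> to all entries
  of a matrix changes its determinant affinely in \<open>x\<close>; for \<open>T\<close> the values \<open>x = -a\<close> and \<open>x = -b\<close> give
  triangular matrices, and for order \<open>m\<close> interpolation yields \<open>(b - a) det T = b (d - a)\<^sup>m - a (d - b)\<^sup>m\<close>.
\<close>

definition binomial_transform :: "(nat \<Rightarrow> 'a::comm_semiring_1) \<Rightarrow> nat \<Rightarrow> 'a" where
  "binomial_transform f n = (\<Sum>k\<le>n. of_nat (n choose k) * f k)"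

lemma binomial_transform_0 [simp]: "binomial_transform f 0 = f 0"
  by (simp add: binomial_transform_def)

lemma binomial_transform_add:
  "binomial_transform (\<lambda>k. f k + g k) n = binomial_transform f n + binomial_transform g n"
  by (simp add: binomial_transform_def distrib_left sum.distrib)

text \<open>Pascal's rule splits each coefficient. In operator form, with \<open>S\<close> the
  shift, passing from \<open>n\<close> to \<open>Suc n\<close> applies \<open>1 + S\<close> to the
  sequence.\<close>

lemma binomial_transform_Suc:
  "binomial_transform f (Suc n) = binomial_transform f n + binomial_transform (\<lambda>k. f (Suc k)) n"
proof -
  have "(\<Sum>k\<le>n. of_nat (n choose Suc k) * f (Suc k)) + f 0
      = (\<Sum>k\<le>Suc n. of_nat (n choose k) * f k)"
    by (subst sum.atMost_Suc_shift) (simp add: add.commute)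
  also have "\<dots> = binomial_transform f n"
    by (simp add: binomial_transform_def binomial_eq_0)
  finally have "(\<Sum>k\<le>n. of_nat (n choose Suc k) * f (Suc k)) + f 0 = binomial_transform f n" .
  moreover have "binomial_transform f (Suc n) =
      ((\<Sum>k\<le>n. of_nat (n choose Suc k) * f (Suc k)) + f 0) + binomial_transform (\<lambda>k. f (Suc k)) n"
    unfolding binomial_transform_def
    by (subst sum.atMost_Suc_shift) (simp add: distrib_right sum.distrib add_ac)
  ultimately show ?thesis
    by simp
qed

text \<open>Padding with vanishing coefficients gives the fixed summation range of a matrix
  product.\<close>

lemma binomial_transform_extend:
  assumes "n < m"
  shows "binomial_transform f n = (\<Sum>k = 0..<m. of_nat (n choose k) * f k)"
  unfolding binomial_transform_def
  by (rule sum.mono_neutral_left) (use assms in \<open>auto simp: binomial_eq_0\<close>)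

lemma binomial_transform_eventually_const:
  fixes b d :: "'a::comm_ring_1"
  shows "binomial_transform (\<lambda>k. if k = 0 then d else b) n = b * 2 ^ n + (d - b)"
proof (induction n)
  case (Suc n)
  have "binomial_transform (\<lambda>k. b) n = b * 2 ^ n"
    by (induction n) (simp_all add: binomial_transform_Suc algebra_simps)
  with Suc show ?case
    by (simp add: binomial_transform_Suc algebra_simps)
qed simp

text \<open>With \<open>S1\<close>, \<open>S2\<close> the shifts of the two indices of
  \<open>T\<close>, the Toeplitz condition says \<open>S1 S2 = 1\<close>. Hence
  \<open>(1 + S1)(1 + S2) = (1 + S1) + (1 + S2)\<close>, which is the recurrence of the
  triangle.\<close>

lemma pascal_entry_binomial_transform:
  fixes T :: "nat \<Rightarrow> nat \<Rightarrow> 'a::comm_semiring_1"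
  assumes "\<And>i j. T (Suc i) (Suc j) = T i j"
    and "\<And>i. \<alpha> i = binomial_transform (\<lambda>k. T k 0) i"
    and "\<And>j. \<beta> j = binomial_transform (T 0) j"
  shows "pascal_entry \<alpha> \<beta> i j = binomial_transform (\<lambda>k. binomial_transform (T k) j) i"
proof (induction i arbitrary: j)
  case 0
  show ?case
    by (cases j) (simp_all add: assms(2,3))
next
  case (Suc i)
  show ?case
  proof (induction j)
    case 0
    show ?case
      by (simp add: assms(2))
  next
    case (Suc j)
    then show ?case
      using \<open>\<And>j. pascal_entry \<alpha> \<beta> i j = _ j\<close>
      by (simp add: binomial_transform_Suc binomial_transform_add assms(1) ac_simps)
  qed
qed

lemma det_pascal_mat_eq_det_toeplitz:
  fixes T :: "nat \<Rightarrow> nat \<Rightarrow> 'a::comm_ring_1"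
  assumes "\<And>i j. T (Suc i) (Suc j) = T i j"
    and "\<And>i. \<alpha> i = binomial_transform (\<lambda>k. T k 0) i"
    and "\<And>j. \<beta> j = binomial_transform (T 0) j"
  shows "det (pascal_mat \<alpha> \<beta> n) = det (mat (n + 1) (n + 1) (\<lambda>(i, j). T i j))"
proof -
  define m where "m = n + 1"
  define L where "L = mat m m (\<lambda>(i, k). of_nat (i choose k) :: 'a)"
  define A where "A = mat m m (\<lambda>(i, j). T i j)"
  have carrier: "L \<in> carrier_mat m m" "A \<in> carrier_mat m m"
    by (simp_all add: L_def A_def)
  have "pascal_mat \<alpha> \<beta> n = L * (A * transpose_mat L)"
  proof (rule eq_matI)
    fix i j
    assume "i < dim_row (L * (A * transpose_mat L))" "j < dim_col (L * (A * transpose_mat L))"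
    then have ij: "i < m" "j < m"
      by (simp_all add: L_def)
    have "pascal_mat \<alpha> \<beta> n $$ (i, j)
        = binomial_transform (\<lambda>k. binomial_transform (T k) j) i"
      using ij pascal_entry_binomial_transform[of T \<alpha> \<beta>, OF assms]
      by (simp add: pascal_mat_def m_def)
    also have "\<dots> = (L * (A * transpose_mat L)) $$ (i, j)"
      using ij by (simp add: L_def A_def scalar_prod_def binomial_transform_extend mult.commute)
    finally show "pascal_mat \<alpha> \<beta> n $$ (i, j) = (L * (A * transpose_mat L)) $$ (i, j)" .
  qed (simp_all add: pascal_mat_def L_def m_def)
  moreover have "det L = 1"
  proof -
    have "det L = prod_list (diag_mat L)"
      by (rule det_lower_triangular[OF _ carrier(1)]) (simp add: L_def binomial_eq_0)
    then show ?thesis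
      by (simp add: prod_list_diag_prod L_def)
  qed
  moreover have "det (L * (A * transpose_mat L)) = det L * (det A * det L)"
    using carrier by (simp add: det_mult[of _ m] det_transpose[of _ m])
  ultimately show ?thesis
    by (simp add: A_def m_def)
qed

text \<open>After subtracting row 0 from all other rows, \<open>x\<close> survives in row 0 only.\<close>

lemma det_add_const_affine:
  fixes f :: "nat \<Rightarrow> nat \<Rightarrow> 'a::comm_ring_1"
  shows "\<exists>p q. \<forall>x. det (mat m m (\<lambda>(i, j). f i j + x)) = p + q * x"
proof (cases "m = 0")
  case True
  then have "\<forall>x. det (mat m m (\<lambda>(i, j). f i j + x)) = 1 + 0 * x"
    by (simp add: det_dim_zero)
  then show ?thesis
    by blast
next
  case False
  \<comment> \<open>Left multiplication by \<open>L\<close> performs the row subtractions.\<close>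
  define L :: "'a mat" where
    "L = mat m m (\<lambda>(i, k). (if k = i then 1 else 0) - (if k = 0 \<and> i \<noteq> 0 then 1 else 0))"
  define M where "M x = mat m m (\<lambda>(i, j). f i j + x)" for x
  define N where "N x = mat m m (\<lambda>(i, j). if i = 0 then f 0 j + x else f i j - f 0 j)" for x
  have carrier: "L \<in> carrier_mat m m" "M x \<in> carrier_mat m m" "N x \<in> carrier_mat m m" for x
    by (simp_all add: L_def M_def N_def)
  have "det L = prod_list (diag_mat L)"
    by (rule det_lower_triangular[OF _ carrier(1)]) (simp add: L_def)
  then have "det L = 1"
    by (simp add: prod_list_diag_prod L_def cong: conj_cong)
  moreover have "N x = L * M x" for x
  proof (rule eq_matI)
    fix i j
    assume "i < dim_row (L * M x)" "j < dim_col (L * M x)"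
    then have ij: "i < m" "j < m"
      by (simp_all add: L_def M_def)
    then have "(L * M x) $$ (i, j) = (\<Sum>k = 0..<m.
        (if k = i then f k j + x else 0) - (if k = 0 then if i \<noteq> 0 then f k j + x else 0 else 0))"
      by (simp add: L_def M_def scalar_prod_def) (intro sum.cong, auto)
    also have "\<dots> = N x $$ (i, j)"
      using ij by (simp add: N_def sum_subtractf)
    finally show "N x $$ (i, j) = (L * M x) $$ (i, j)"
      by simp
  qed (simp_all add: L_def M_def N_def)
  ultimately have det_eq: "det (M x) = det (N x)" for x
    using carrier by (simp add: det_mult[of _ m])
  \<comment> \<open>Deleting row 0 removes every occurrence of \<open>x\<close>, so the expansion
    along row 0 is affine in \<open>x\<close>.\<close>
  have cofactor: "cofactor (N x) 0 j = cofactor (N 0) 0 j" for x j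
  proof -
    have "mat_delete (N x) 0 j = mat_delete (N 0) 0 j"
      by (rule eq_matI) (auto simp: mat_delete_def N_def)
    then show ?thesis
      by (simp add: cofactor_def)
  qed
  have "det (N x) = (\<Sum>j<m. N x $$ (0, j) * cofactor (N 0) 0 j)" for x
    using laplace_expansion_row[OF carrier(3), of 0 x] False by (simp add: cofactor[of x])
  then have "det (N x)
      = (\<Sum>j<m. f 0 j * cofactor (N 0) 0 j) + (\<Sum>j<m. cofactor (N 0) 0 j) * x" for x
    using False
    by (simp add: N_def distrib_right sum.distrib sum_distrib_left mult.commute)
  with det_eq show ?thesis
    unfolding M_def by metis
qed

lemma det_three_valued_toeplitz:
  fixes a b d :: "'a::comm_ring_1"
  shows "(b - a) * det (mat m m (\<lambda>(i, j). if i = j then d else if j < i then b else a))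
       = b * (d - a) ^ m - a * (d - b) ^ m"
proof -
  define f where "f i j = (if i = j then d else if j < i then b else a)" for i j :: nat
  define M where "M x = mat m m (\<lambda>(i, j). f i j + x)" for x
  obtain p q where affine: "det (M x) = p + q * x" for x
    using det_add_const_affine[of m f] unfolding M_def by blast
  have "det (M (- a)) = prod_list (diag_mat (M (- a)))"
    by (rule det_lower_triangular[of m]) (simp_all add: M_def f_def)
  then have a: "p - q * a = (d - a) ^ m"
    using affine[of "- a"] by (simp add: prod_list_diag_prod M_def f_def)
  have "det (M (- b)) = prod_list (diag_mat (M (- b)))"
    by (rule det_upper_triangular[of _ m]) (auto simp add: M_def f_def)
  then have b: "p - q * b = (d - b) ^ m"
    using affine[of "- b"] by (simp add: prod_list_diag_prod M_def f_def)
  \<comment> \<open>Here \<open>det (M 0) = p\<close>, and in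
    \<open>b * (p - q * a) - a * (p - q * b)\<close> the terms with \<open>q\<close> cancel.\<close>
  have "(b - a) * det (M 0) = b * (d - a) ^ m - a * (d - b) ^ m"
    unfolding a[symmetric] b[symmetric] affine by (simp add: algebra_simps)
  then show ?thesis
    by (simp add: M_def f_def)
qed

text \<open>These boundaries are the binomial transforms of \<open>d, b, b, ...\<close> and
  \<open>d, a, a, ...\<close>.\<close>

lemma det_pascal_mat_affine_powers:
  fixes a b d :: "'a::comm_ring_1"
  assumes "\<And>i. \<alpha> i = b * 2 ^ i + (d - b)" and "\<And>j. \<beta> j = a * 2 ^ j + (d - a)"
  shows "(b - a) * det (pascal_mat \<alpha> \<beta> n) = b * (d - a) ^ (n + 1) - a * (d - b) ^ (n + 1)"
proof -
  define T where "T i j = (if i = j then d else if j < i then b else a)" for i j :: nat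
  have "(\<lambda>k. T k 0) = (\<lambda>k. if k = 0 then d else b)" "T 0 = (\<lambda>k. if k = 0 then d else a)"
    by (auto simp: T_def)
  then have "det (pascal_mat \<alpha> \<beta> n) = det (mat (n + 1) (n + 1) (\<lambda>(i, j). T i j))"
    by (intro det_pascal_mat_eq_det_toeplitz)
      (simp_all add: assms binomial_transform_eventually_const, simp add: T_def)
  then show ?thesis
    unfolding T_def by (simp only: det_three_valued_toeplitz)
qed

text \<open>The bases 2 and -1 are the roots of \<open>x^2 = x + 2\<close>.\<close>

lemma jacobsthal_closed_form: "3 * real (jacobsthal n) = 2 ^ n - (- 1) ^ n"
  by (induction n rule: jacobsthal.induct) (simp_all add: algebra_simps)

theorem corollary8:
  fixes \<alpha> \<beta> :: "nat \<Rightarrow> real"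
  assumes "\<alpha> 0 = \<beta> 0"
  shows "((\<forall>i. \<alpha> i = 2 ^ (i + 1) - 1) \<and> (\<forall>i. \<beta> i = 2 * (1 - 2 powi (int i - 1)))
            \<longrightarrow> (\<forall>n. det (pascal_mat \<alpha> \<beta> n) = real (jacobsthal (n + 2))))
       \<and> ((\<forall>i. \<alpha> i = 2 ^ (i + 2) - 1) \<and> (\<forall>i. \<beta> i = 2 * (2 powi (int i - 1) + 1))
            \<longrightarrow> (\<forall>n. det (pascal_mat \<alpha> \<beta> n) = real (jacobsthal (n + 3))))"
proof (intro conjI impI allI)
  fix n
  assume h: "(\<forall>i. \<alpha> i = 2 ^ (i + 1) - 1) \<and> (\<forall>i. \<beta> i = 2 * (1 - 2 powi (int i - 1)))"
  \<comment> \<open>Rewriting \<alpha> as \<open>2 * 2 ^ i - 1\<close> and \<beta> as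
    \<open>- (2 ^ i) + 2\<close> gives \<open>b = 2\<close>, \<open>a = -1\<close>,
    \<open>d = 1\<close>.\<close>
  have "(2 - (- 1)) * det (pascal_mat \<alpha> \<beta> n)
      = 2 * (1 - (- 1)) ^ (n + 1) - (- 1) * (1 - 2) ^ (n + 1)"
    by (rule det_pascal_mat_affine_powers) (simp_all add: h power_int_diff)
  then show "det (pascal_mat \<alpha> \<beta> n) = real (jacobsthal (n + 2))"
    using jacobsthal_closed_form[of "n + 2"] by simp
next
  fix n
  assume h: "(\<forall>i. \<alpha> i = 2 ^ (i + 2) - 1) \<and> (\<forall>i. \<beta> i = 2 * (2 powi (int i - 1) + 1))"
  \<comment> \<open>Now \<open>b = 4\<close>, \<open>a = 1\<close>, \<open>d = 3\<close>; again
    \<open>b - a = 3\<close>, \<open>d - a = 2\<close> and \<open>d - b = -1\<close>, matching the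
    closed form.\<close>
  have "(4 - 1) * det (pascal_mat \<alpha> \<beta> n) = 4 * (3 - 1) ^ (n + 1) - 1 * (3 - 4) ^ (n + 1)"
    by (rule det_pascal_mat_affine_powers) (simp_all add: h power_int_diff)
  then show "det (pascal_mat \<alpha> \<beta> n) = real (jacobsthal (n + 3))"
    using jacobsthal_closed_form[of "n + 3"] by (simp add: power_add)
qed

end
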